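(* For all integers $n \ge k > 0$ we have \[ \phi\left(n,k,\tfrac{1}{2}k^{\log_2 3}-1\right) = O\left(n^{\log_2 3}\right), \] that is, there is an absolute constant $C>0$ (independent of $n$ and $k$) such that $\phi\left(n,k,\tfrac{1}{2}k^{\log_2 3}-1\right) \le C\, n^{\log_2 3}$ for all integers $n\ge k>0$.
   Context: The distances spanned by a finite set $S\subset\mathbb{R}^2$ are the positive reals $|u-v|$ (Euclidean distance) with $u,v\in S$, $u\ne v$; the number of distinct distances spanned by $S$ is the number of distinct such values. For integers $n,k$ and a real number $\ell$, $\phi(n,k,\ell)$ denotes the minimum number of distinct distances spanned by $S$, over all sets $S$ of $n$ points in $\mathbb{R}^2$ with the property that every subset of $k$ points of $S$ spans at least $\ell$ distinct distances. The parameter $k$ is allowed to depend on $n$. *)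

theory Defs
  imports "HOL-Analysis.Analysis"
begin

definition distances :: "(real ^ 2) set \<Rightarrow> real set" where
  "distances S = {dist u v | u v. u \<in> S \<and> v \<in> S \<and> u \<noteq> v}"

definition locally_rich :: "nat \<Rightarrow> real \<Rightarrow> (real ^ 2) set \<Rightarrow> bool" where
  "locally_rich k l S \<longleftrightarrow>
     (\<forall>T. T \<subseteq> S \<and> card T = k \<longrightarrow> l \<le> real (card (distances T)))"

text \<open>
  The values are in \<^typ>\<open>enat\<close>, so that the infimum over an empty family is \<open>\<infinity>\<close>: an upper
  bound on \<open>\<phi>\<close> by a finite quantity asserts in particular that an admissible set exists.
  Over a nonempty family the infimum is attained, so it is the minimum.
\<close>

definition \<phi> :: "nat \<Rightarrow> nat \<Rightarrow> real \<Rightarrow> enat" where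
  "\<phi> n k l =
     (INF S \<in> {S. finite S \<and> card S = n \<and> locally_rich k l S}. enat (card (distances S)))"

end

theory Submission
  imports Defs "HOL-Real_Asymp.Real_Asymp"
begin

text \<open>
  Let \<open>n \<le> 2 ^ m \<le> 2 * n\<close>, take the cube of the \<open>2 ^ m\<close> collinear points
  \<open>\<Sum>i<m. \<epsilon>\<^sub>i * 3 ^ i\<close> with digits \<open>\<epsilon>\<^sub>i \<in> {0, 1}\<close>, and let \<open>S\<close> be any \<open>n\<close> of them. Their differences have balanced ternary digits, so there are only
  \<open>3 ^ m\<close> of them, which is \<open>O(n powr log 2 3)\<close>. Conversely \<open>|A - A| \<ge> |A| powr log 2 3\<close> for every
  subset \<open>A\<close> of the cube, and up to sign each distance accounts for two differences. This bound
  is the diagonal case of \<open>|A - B| \<ge> (|A| * |B|) powr (log 2 3 / 2)\<close>, proved by splitting \<open>A\<close> and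
  \<open>B\<close> according to the last digit. The induction step rests on the inequality
  \<open>(a + b) powr p \<le> a powr p + (a * b) powr (p / 2) + b powr p\<close> for \<open>p = log 2 3\<close>, which is
  \<open>(2 * cosh t) powr p \<le> 1 + 2 * cosh (p * t)\<close> after putting \<open>a = exp (s - t)\<close>, \<open>b = exp (s + t)\<close>.
\<close>

section \<open>The analytic inequality behind the exponent \<open>log 2 3\<close>\<close>

lemma sinh_scaled_mult_cosh_ge:
  fixes r t :: real
  assumes "0 \<le> r" "r \<le> 1" "0 \<le> t"
  shows "r * cosh (r * t) * sinh t \<le> sinh (r * t) * cosh t"
proof -
  let ?f = "\<lambda>t. sinh (r * t) * cosh t - r * cosh (r * t) * sinh t"
  have "?f 0 \<le> ?f t"
  proof (rule DERIV_nonneg_imp_nondecreasing[OF assms(3)])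
    fix x :: real assume x: "0 \<le> x" "x \<le> t"
    have "(?f has_real_derivative (1 - r\<^sup>2) * (sinh (r * x) * sinh x)) (at x)"
      by (auto intro!: derivative_eq_intros simp: algebra_simps power2_eq_square)
    moreover have "0 \<le> (1 - r\<^sup>2) * (sinh (r * x) * sinh x)"
      using assms x by (intro mult_nonneg_nonneg) (auto simp: power_le_one)
    ultimately show "\<exists>y. (?f has_real_derivative y) (at x) \<and> 0 \<le> y" by blast
  qed
  thus ?thesis by simp
qed

text \<open>The quotient rule leaves exactly the difference bounded in the preceding lemma as
  numerator. It is used with \<open>r = log 2 3 - 1\<close>, where comparing this ratio with 1/2
  decides the sign of the derivative \<open>g'\<close> below.\<close>

lemma sinh_scaled_ratio_antimono:
  fixes r s t :: real
  assumes r: "0 \<le> r" "r \<le> 1" and "0 < s" "s \<le> t"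
  shows "sinh (r * t) / sinh t \<le> sinh (r * s) / sinh s"
proof (rule DERIV_nonpos_imp_nonincreasing[OF assms(4)])
  fix x :: real assume x: "s \<le> x" "x \<le> t"
  hence pos: "0 < x" "0 < sinh x" using assms by auto
  have "((\<lambda>t. sinh (r * t) / sinh t) has_real_derivative
      (r * cosh (r * x) * sinh x - sinh (r * x) * cosh x) / (sinh x * sinh x)) (at x)"
    using pos by (auto intro!: derivative_eq_intros simp: algebra_simps)
  moreover have "(r * cosh (r * x) * sinh x - sinh (r * x) * cosh x) / (sinh x * sinh x) \<le> 0"
    using sinh_scaled_mult_cosh_ge[OF r, of x] pos
    by (intro divide_nonpos_pos) auto
  ultimately show "\<exists>y. ((\<lambda>t. sinh (r * t) / sinh t) has_real_derivative y) (at x) \<and> y \<le> 0"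
    by blast
qed

lemma log_2_3_bounds: "1 < log 2 3" "log 2 3 < 2"
  by (auto simp: less_log_iff log_less_iff powr_numeral)

lemma exp_mult_two_cosh: "exp s * (2 * cosh t) = exp (s + t) + exp (s - t)" for s t :: real
  by (simp add: cosh_field_def exp_add exp_diff exp_minus field_simps)

lemma cosh_powr_log_2_3_le:
  fixes t :: real
  assumes "0 \<le> t"
  shows "(2 * cosh t) powr log 2 3 \<le> 1 + 2 * cosh (log 2 3 * t)"
proof -
  define p :: real where "p = log 2 3"
  have p: "1 < p" "p < 2" using log_2_3_bounds by (auto simp: p_def)
  define g where "g = (\<lambda>t::real. ln (1 + 2 * cosh (p * t)) - p * ln (2 * cosh t))"
  define g' where "g' = (\<lambda>t::real. p * (2 * sinh ((p - 1) * t) - sinh t) /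
    ((1 + 2 * cosh (p * t)) * cosh t))"
  have cpos: "0 < 1 + 2 * cosh x" for x :: real
    using cosh_real_pos[of x] by linarith
  have deriv: "(g has_real_derivative g' x) (at x)" for x
  proof -
    \<comment> \<open>Over the common denominator, the numerator \<open>p * (2 * sinh (p * x) * cosh
      x - 2 * cosh (p * x) * sinh x - sinh x)\<close> collapses by this subtraction formula.\<close>
    have *: "sinh ((p - 1) * x) = sinh (p * x) * cosh x - cosh (p * x) * sinh x"
      by (simp add: left_diff_distrib sinh_diff)
    have "(g has_real_derivative
        2 * sinh (p * x) * p / (1 + 2 * cosh (p * x)) - p * (sinh x / cosh x)) (at x)"
      unfolding g_def using cpos[of "p * x"] cosh_real_pos[of x]
      by (auto intro!: derivative_eq_intros simp: field_simps)
    moreover have "2 * sinh (p * x) * p / (1 + 2 * cosh (p * x)) - p * (sinh x / cosh x) = g' x"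
      unfolding g'_def * using cpos[of "p * x"] cosh_real_pos[of x]
      by (simp add: divide_simps) (simp add: algebra_simps)
    ultimately show ?thesis by simp
  qed
  \<comment> \<open>The value is \<open>ln 3 - p * ln 2\<close>, so it vanishes precisely for the
    exponent \<open>p = log 2 3\<close>.\<close>
  have g0: "g 0 = 0"
    by (simp add: g_def p_def log_def)
  \<comment> \<open>Keep only \<open>exp (p * x)\<close> in \<open>1 + 2 * cosh (p * x)\<close>; the
    linear terms \<open>p * x\<close> of the two logarithms then cancel.\<close>
  have lower: "- p * ln (1 + exp (- 2 * x)) \<le> g x" for x
  proof -
    have "p * x = ln (exp (p * x))" by simp
    also have "\<dots> \<le> ln (1 + 2 * cosh (p * x))"
    proof (subst ln_le_cancel_iff)
      show "exp (p * x) \<le> 1 + 2 * cosh (p * x)"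
        using exp_mult_two_cosh[of 0 "p * x"] exp_gt_zero[of "0 - p * x"] by simp
    qed (use cpos in auto)
    finally have 1: "p * x \<le> ln (1 + 2 * cosh (p * x))" .
    have "2 * cosh x = exp x * (1 + exp (- 2 * x))"
      using exp_mult_two_cosh[of 0 x] by (simp add: distrib_left flip: exp_add)
    hence "ln (2 * cosh x) = x + ln (1 + exp (- 2 * x))"
      by (simp add: ln_mult add_pos_pos less_imp_neq[THEN not_sym])
    with 1 show ?thesis by (simp add: g_def algebra_simps)
  qed
  \<comment> \<open>Once \<open>g'\<close> is negative it stays nonpositive, as \<open>sinh ((p - 1) x) / sinh x\<close> decreases.
    So a negative value of \<open>g\<close> would contradict \<open>lower\<close>, which tends to 0.\<close>
  have "0 \<le> g t"
  proof (rule ccontr)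
    assume "\<not> 0 \<le> g t"
    hence neg: "g t < 0" by simp
    with g0 assms have t: "0 < t" by (cases "t = 0") auto
    obtain s where s: "0 < s" "s < t" "g t - g 0 = (t - 0) * g' s"
      using MVT2[OF t, of g g'] deriv by blast
    hence "g' s < 0" using neg g0 t by (simp add: mult_less_0_iff)
    hence "2 * sinh ((p - 1) * s) - sinh s < 0"
      using p cpos[of "p * s"] cosh_real_pos[of s]
      by (simp add: g'_def divide_less_0_iff mult_less_0_iff zero_less_mult_iff)
    hence ratio: "sinh ((p - 1) * s) / sinh s < 1 / 2"
      using s by (simp add: divide_simps)
    have g'_neg: "g' x \<le> 0" if "s \<le> x" for x
    proof -
      have "sinh ((p - 1) * x) / sinh x \<le> 1 / 2"
        using sinh_scaled_ratio_antimono[of "p - 1" s x] ratio p s that by linarith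
      moreover have "0 < sinh x" using s that by simp
      ultimately have "2 * sinh ((p - 1) * x) - sinh x \<le> 0"
        by (simp add: divide_simps)
      thus ?thesis using p cpos[of "p * x"] cosh_real_pos[of x]
        unfolding g'_def by (intro divide_nonpos_pos mult_nonneg_nonpos mult_pos_pos) auto
    qed
    have decr: "g x \<le> g t" if "t \<le> x" for x
      using that s g'_neg deriv
      by (intro DERIV_nonpos_imp_nonincreasing[of t x g]) force+
    have "((\<lambda>x. - p * ln (1 + exp (- 2 * x))) \<longlongrightarrow> 0) at_top"
      by real_asymp
    moreover have "eventually (\<lambda>x. - p * ln (1 + exp (- 2 * x)) \<le> g t) at_top"
      using eventually_ge_at_top[of t] by eventually_elim (use lower decr order_trans in blast)
    ultimately have "0 \<le> g t" by (intro tendsto_upperbound) auto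
    with neg show False by simp
  qed
  hence "p * ln (2 * cosh t) \<le> ln (1 + 2 * cosh (p * t))" by (simp add: g_def)
  hence "exp (p * ln (2 * cosh t)) \<le> exp (ln (1 + 2 * cosh (p * t)))"
    by (subst exp_le_cancel_iff)
  moreover have "exp (ln (1 + 2 * cosh (p * t))) = 1 + 2 * cosh (p * t)" by (rule exp_ln[OF cpos])
  moreover have "(2 * cosh t) powr p = exp (p * ln (2 * cosh t))"
    using cosh_real_pos[of t] by (simp add: powr_def)
  ultimately show ?thesis by (simp only: p_def)
qed

lemma add_powr_log_2_3_le_aux:
  fixes a b :: real
  assumes "0 < a" "a \<le> b"
  shows "(a + b) powr log 2 3 \<le> a powr log 2 3 + (a * b) powr (log 2 3 / 2) + b powr log 2 3"
proof -
  define p :: real where "p = log 2 3"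
  define u v where "u = ln a" and "v = ln b"
  have ab: "a = exp u" "b = exp v" using assms by (auto simp: u_def v_def)
  define t where "t = (v - u) / 2"
  have "0 \<le> t" using assms by (simp add: t_def u_def v_def)
  have 1: "a + b = exp ((u + v) / 2) * (2 * cosh t)"
  proof -
    have "(u + v) / 2 + t = v" "(u + v) / 2 - t = u" by (simp_all add: t_def field_simps)
    thus ?thesis by (simp only: ab exp_mult_two_cosh add.commute)
  qed
  have "(a + b) powr p = exp (p * ((u + v) / 2)) * (2 * cosh t) powr p"
    unfolding 1 by (subst powr_mult) (auto simp: cosh_real_nonneg powr_def)
  also have "\<dots> \<le> exp (p * ((u + v) / 2)) * (1 + 2 * cosh (p * t))"
    using cosh_powr_log_2_3_le[OF \<open>0 \<le> t\<close>] by (simp add: p_def)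
  also have "\<dots> = exp (p * u) + exp (p * ((u + v) / 2)) + exp (p * v)"
  proof -
    have "p * ((u + v) / 2) + p * t = p * v" "p * ((u + v) / 2) - p * t = p * u"
      by (simp_all add: t_def field_simps)
    thus ?thesis by (simp only: distrib_left exp_mult_two_cosh)
  qed
  also have "\<dots> = a powr p + (a * b) powr (p / 2) + b powr p"
    by (simp add: ab powr_def ln_mult algebra_simps flip: exp_add)
  finally show ?thesis by (simp add: p_def)
qed

lemma add_powr_log_2_3_le:
  fixes a b :: real
  assumes "0 \<le> a" "0 \<le> b"
  shows "(a + b) powr log 2 3 \<le> a powr log 2 3 + (a * b) powr (log 2 3 / 2) + b powr log 2 3"
proof -
  consider "a = 0" | "b = 0" | "0 < a" "a \<le> b" | "0 < b" "b \<le> a" using assms by linarith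
  thus ?thesis
  proof cases
    case 3 thus ?thesis by (rule add_powr_log_2_3_le_aux)
  next
    case 4 thus ?thesis using add_powr_log_2_3_le_aux[of b a] by (simp add: ac_simps)
  qed auto
qed

text \<open>Of the products \<open>a * c\<close> and \<open>b * d\<close> only the larger may appear
  on the right, because in the induction on digits the two corresponding difference sets can
  overlap. After squaring, \<open>add_powr_log_2_3_le\<close> applies to each factor.\<close>

lemma mult_add_powr_le:
  fixes a b c d :: real
  assumes nn: "0 \<le> a" "0 \<le> b" "0 \<le> c" "0 \<le> d"
  assumes q: "q = log 2 3 / 2" and le: "b * d \<le> a * c"
  shows "((a + b) * (c + d)) powr q \<le> (a * d) powr q + (b * c) powr q + (a * c) powr q"
proof -
  define A B C D where "A = a powr q" "B = b powr q" "C = c powr q" "D = d powr q"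
  note defs = this
  have nn': "0 \<le> A" "0 \<le> B" "0 \<le> C" "0 \<le> D" by (auto simp: defs)
  have "0 \<le> q" using log_2_3_bounds by (simp add: q)
  hence le': "B * D \<le> A * C"
    using le nn by (auto simp: defs simp flip: powr_mult intro!: powr_mono2)
  have sq: "(x powr q)\<^sup>2 = x powr log 2 3" for x :: real
    by (simp add: q power2_eq_square flip: powr_add)
  have 1: "((x + y) powr q)\<^sup>2 \<le> (x powr q)\<^sup>2 + x powr q * y powr q + (y powr q)\<^sup>2"
    if "0 \<le> x" "0 \<le> y" for x y :: real
    unfolding sq using add_powr_log_2_3_le[OF that] that by (simp add: q powr_mult)
  have "(((a + b) * (c + d)) powr q)\<^sup>2 = ((a + b) powr q)\<^sup>2 * ((c + d) powr q)\<^sup>2"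
    using nn by (simp add: powr_mult power_mult_distrib)
  also have "\<dots> \<le> (A\<^sup>2 + A * B + B\<^sup>2) * (C\<^sup>2 + C * D + D\<^sup>2)"
    unfolding defs using nn by (intro mult_mono 1) auto
  \<comment> \<open>The subtracted product is the exact slack, and \<open>le'\<close> makes it
    nonnegative.\<close>
  also have "\<dots> = (A * D + B * C + A * C)\<^sup>2 - (B * C + A * D + B * D) * (A * C - B * D)"
    by (simp add: power2_eq_square algebra_simps)
  also have "\<dots> \<le> (A * D + B * C + A * C)\<^sup>2"
    using le' nn' by simp
  finally have "((a + b) * (c + d)) powr q \<le> A * D + B * C + A * C"
    using nn' by (auto intro: power2_le_imp_le)
  thus ?thesis using nn by (simp add: defs powr_mult)
qed

section \<open>Difference sets of subsets of the ternary cube\<close>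

definition diff_set :: "int set \<Rightarrow> int set \<Rightarrow> int set" where
  "diff_set A B = (\<lambda>(a, b). a - b) ` (A \<times> B)"

lemma mem_diff_set: "x \<in> diff_set A B \<longleftrightarrow> (\<exists>a\<in>A. \<exists>b\<in>B. x = a - b)"
  by (auto simp: diff_set_def)

lemma finite_diff_set: "finite A \<Longrightarrow> finite B \<Longrightarrow> finite (diff_set A B)"
  by (simp add: diff_set_def)

text \<open>A difference of two elements determines its balanced ternary digits, so for the purpose
  of difference sets this is the discrete cube \<open>{0, 1} ^ m\<close>.\<close>

fun ternary_cube :: "nat \<Rightarrow> int set" where
  "ternary_cube 0 = {0}"
| "ternary_cube (Suc m) = (\<lambda>x. 3 * x) ` ternary_cube m \<union> (\<lambda>x. 3 * x + 1) ` ternary_cube m"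

lemma finite_ternary_cube: "finite (ternary_cube m)"
  by (induction m) auto

text \<open>The bound 3 covers any two of the balanced digits -1, 0, 1, which differ by at most 2;
  it makes such digits unique.\<close>

lemma triple_plus_eq_iff:
  fixes x y i j :: int
  assumes "\<bar>i - j\<bar> < 3"
  shows "3 * x + i = 3 * y + j \<longleftrightarrow> x = y \<and> i = j"
  using assms by presburger

lemma card_triple_plus: "card ((\<lambda>x::int. 3 * x + i) ` A) = card A"
  by (rule card_image) (auto simp: inj_on_def)

lemma card_ternary_cube: "card (ternary_cube m) = 2 ^ m"
proof (induction m)
  case (Suc m)
  have "(\<lambda>x. 3 * x + 0) ` ternary_cube m \<inter> (\<lambda>x. 3 * x + 1) ` ternary_cube m = {}"
    using triple_plus_eq_iff[of 0 1] by auto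
  hence "card ((\<lambda>x. 3 * x + 0) ` ternary_cube m \<union> (\<lambda>x. 3 * x + 1) ` ternary_cube m)
      = 2 ^ m + 2 ^ m"
    using Suc by (subst card_Un_disjoint) (auto simp only: finite_ternary_cube finite_imageI card_triple_plus)
  thus ?case by simp
qed simp

lemma diff_set_Un:
  "diff_set (A \<union> A') B = diff_set A B \<union> diff_set A' B"
  "diff_set A (B \<union> B') = diff_set A B \<union> diff_set A B'"
  by (auto simp: diff_set_def)

lemma diff_set_triple_plus:
  "diff_set ((\<lambda>x. 3 * x + i) ` A) ((\<lambda>x. 3 * x + j) ` B) = (\<lambda>x. 3 * x + (i - j)) ` diff_set A B"
proof -
  have "3 * a + i - (3 * b + j) = 3 * (a - b) + (i - j)" for a b by simp
  thus ?thesis by (simp only: diff_set_def image_paired_Times[symmetric] image_image split_beta fst_conv snd_conv)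
qed

lemma diff_set_digits:
  "diff_set ((\<lambda>x. 3 * x) ` A \<union> (\<lambda>x. 3 * x + 1) ` A') ((\<lambda>x. 3 * x) ` B \<union> (\<lambda>x. 3 * x + 1) ` B')
    = (\<lambda>x. 3 * x + 0) ` (diff_set A B \<union> diff_set A' B') \<union>
      ((\<lambda>x. 3 * x + (-1)) ` diff_set A B' \<union> (\<lambda>x. 3 * x + 1) ` diff_set A' B)"
  using diff_set_triple_plus[of 0 A 0 B] diff_set_triple_plus[of 0 A 1 B']
    diff_set_triple_plus[of 1 A' 0 B] diff_set_triple_plus[of 1 A' 1 B']
  by (simp add: diff_set_Un image_Un Un_ac)

text \<open>The last balanced digit of a difference separates three disjoint classes. Digit 0 arises
  both from 0 - 0 and from 1 - 1, hence a union there, while -1 and 1 each arise in one way.\<close>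

lemma card_diff_set_digits:
  assumes "finite A" "finite A'" "finite B" "finite B'"
  shows "card (diff_set ((\<lambda>x. 3 * x) ` A \<union> (\<lambda>x. 3 * x + 1) ` A')
      ((\<lambda>x. 3 * x) ` B \<union> (\<lambda>x. 3 * x + 1) ` B'))
    = card (diff_set A B \<union> diff_set A' B') + card (diff_set A B') + card (diff_set A' B)"
proof -
  have disj: "(\<lambda>x::int. 3 * x + i) ` X \<inter> (\<lambda>x. 3 * x + j) ` Y = {}"
    if "\<bar>i - j\<bar> < 3" "i \<noteq> j" for i j X Y
    using triple_plus_eq_iff[OF that(1)] that(2) by auto
  show ?thesis
    unfolding diff_set_digits
    by (subst card_Un_disjoint, (auto simp only: finite_diff_set assms finite_imageI finite_Un Int_Un_distrib disj)[3])
       (subst card_Un_disjoint, (auto simp only: finite_diff_set assms finite_imageI finite_Un disj card_triple_plus)+)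
qed

lemma card_diff_set_ternary_cube: "card (diff_set (ternary_cube m) (ternary_cube m)) = 3 ^ m"
proof (induction m)
  case (Suc m)
  show ?case
    unfolding ternary_cube.simps
    by (subst card_diff_set_digits) (simp_all add: finite_ternary_cube Suc)
qed (simp add: diff_set_def)

lemma ternary_cube_SucE:
  assumes "A \<subseteq> ternary_cube (Suc m)"
  obtains A0 A1 where "A0 \<subseteq> ternary_cube m" "A1 \<subseteq> ternary_cube m"
    "A = (\<lambda>x. 3 * x) ` A0 \<union> (\<lambda>x. 3 * x + 1) ` A1" "card A = card A0 + card A1"
proof -
  define A0 A1 where "A0 = {x \<in> ternary_cube m. 3 * x \<in> A}" "A1 = {x \<in> ternary_cube m. 3 * x + 1 \<in> A}"
  note defs = this
  have A: "A = (\<lambda>x. 3 * x) ` A0 \<union> (\<lambda>x. 3 * x + 1) ` A1"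
    using assms by (auto simp: defs)
  have fin: "finite A0" "finite A1" by (auto simp: defs finite_ternary_cube)
  have "card ((\<lambda>x. 3 * x + 0) ` A0 \<union> (\<lambda>x. 3 * x + 1) ` A1) = card A0 + card A1"
  proof (subst card_Un_disjoint)
    show "(\<lambda>x. 3 * x + 0) ` A0 \<inter> (\<lambda>x. 3 * x + 1) ` A1 = {}"
      using triple_plus_eq_iff[of 0 1] by auto
  qed (use fin in \<open>simp_all only: finite_imageI card_triple_plus\<close>)
  hence "card A = card A0 + card A1" by (simp add: A)
  with A show ?thesis by (intro that[of A0 A1]) (auto simp: defs)
qed

text \<open>Two sets are needed for the induction: even for \<open>A = B\<close>, splitting by the
  last digit produces differences of distinct sets.\<close>

lemma card_diff_set_ge:
  assumes "A \<subseteq> ternary_cube m" "B \<subseteq> ternary_cube m"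
  shows "(real (card A) * real (card B)) powr (log 2 3 / 2) \<le> real (card (diff_set A B))"
  using assms
proof (induction m arbitrary: A B)
  case 0
  \<comment> \<open>If one set is empty, the left side is \<open>0 powr (log 2 3 / 2)\<close>, which
    is 0.\<close>
  hence "A = {} \<or> A = {0}" "B = {} \<or> B = {0}" by auto
  thus ?case by (auto simp: diff_set_def)
next
  case (Suc m)
  obtain A0 A1 where A: "A0 \<subseteq> ternary_cube m" "A1 \<subseteq> ternary_cube m"
    "A = (\<lambda>x. 3 * x) ` A0 \<union> (\<lambda>x. 3 * x + 1) ` A1" "card A = card A0 + card A1"
    using ternary_cube_SucE[OF Suc.prems(1)] by metis
  obtain B0 B1 where B: "B0 \<subseteq> ternary_cube m" "B1 \<subseteq> ternary_cube m"
    "B = (\<lambda>x. 3 * x) ` B0 \<union> (\<lambda>x. 3 * x + 1) ` B1" "card B = card B0 + card B1"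
    using ternary_cube_SucE[OF Suc.prems(2)] by metis
  have fin: "finite A0" "finite A1" "finite B0" "finite B1"
    using A B finite_ternary_cube finite_subset by metis+
  define q :: real where "q = log 2 3 / 2"
  let ?D = "diff_set A0 B0 \<union> diff_set A1 B1"
  let ?a = "real (card A0)" and ?b = "real (card A1)" and ?c = "real (card B0)" and ?d = "real (card B1)"
  have card_D: "card (diff_set A0 B0) \<le> card ?D" "card (diff_set A1 B1) \<le> card ?D"
    using fin by (auto intro!: card_mono simp: finite_diff_set)
  have IH: "(?a * ?d) powr q \<le> card (diff_set A0 B1)" "(?b * ?c) powr q \<le> card (diff_set A1 B0)"
    "(?a * ?c) powr q \<le> card (diff_set A0 B0)" "(?b * ?d) powr q \<le> card (diff_set A1 B1)"
    unfolding q_def using A B Suc.IH by auto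
  have "((?a + ?b) * (?c + ?d)) powr q \<le> card ?D + card (diff_set A0 B1) + card (diff_set A1 B0)"
  \<comment> \<open>\<open>?D\<close> is bounded below by whichever of its two parts has the larger
    estimate. The second case is the first with digits 0 and 1 interchanged in both sets.\<close>
  proof (cases "?b * ?d \<le> ?a * ?c")
    case True
    show ?thesis using mult_add_powr_le[OF _ _ _ _ q_def True] IH card_D by simp
  next
    case False
    hence "?a * ?c \<le> ?b * ?d" by simp
    from mult_add_powr_le[OF _ _ _ _ q_def this]
    have "((?b + ?a) * (?d + ?c)) powr q \<le> (?b * ?c) powr q + (?a * ?d) powr q + (?b * ?d) powr q"
      by simp
    thus ?thesis using IH card_D by (simp add: add.commute)
  qed
  also have "card ?D + card (diff_set A0 B1) + card (diff_set A1 B0) = card (diff_set A B)"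
    unfolding A B by (simp only: card_diff_set_digits[OF fin])
  finally show ?case by (simp only: A(4) B(4) q_def of_nat_add)
qed

section \<open>From integer differences to distances in the plane\<close>

definition line_point :: "int \<Rightarrow> real ^ 2" where
  "line_point x = axis 1 (real_of_int x)"

lemma dist_line_point: "dist (line_point x) (line_point y) = \<bar>real_of_int (x - y)\<bar>"
proof -
  have "line_point x - line_point y = axis 1 (real_of_int (x - y))"
    by (simp add: line_point_def vec_eq_iff axis_def)
  thus ?thesis by (simp add: dist_norm norm_eq_sqrt_inner inner_axis_axis)
qed

lemma inj_line_point: "inj line_point"
  by (auto simp: inj_def line_point_def axis_eq_axis)

lemma distances_line_point:
  "distances (line_point ` A) = (\<lambda>d. \<bar>real_of_int d\<bar>) ` (diff_set A A - {0})"
proof -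
  have "distances (line_point ` A)
      = {dist (line_point x) (line_point y) | x y. x \<in> A \<and> y \<in> A \<and> line_point x \<noteq> line_point y}"
    unfolding distances_def by blast
  also have "\<dots> = {\<bar>real_of_int (x - y)\<bar> | x y. x \<in> A \<and> y \<in> A \<and> x \<noteq> y}"
    by (simp only: dist_line_point inj_eq[OF inj_line_point])
  also have "\<dots> = (\<lambda>d. \<bar>real_of_int d\<bar>) ` (diff_set A A - {0})"
  proof (intro set_eqI iffI)
    fix z assume "z \<in> {\<bar>real_of_int (x - y)\<bar> | x y. x \<in> A \<and> y \<in> A \<and> x \<noteq> y}"
    then obtain x y where "z = \<bar>real_of_int (x - y)\<bar>" "x - y \<in> diff_set A A - {0}"
      by (auto simp: mem_diff_set)
    thus "z \<in> (\<lambda>d. \<bar>real_of_int d\<bar>) ` (diff_set A A - {0})" by (rule image_eqI)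
  next
    fix z assume "z \<in> (\<lambda>d. \<bar>real_of_int d\<bar>) ` (diff_set A A - {0})"
    then obtain x y where "z = \<bar>real_of_int (x - y)\<bar>" "x \<in> A" "y \<in> A" "x - y \<noteq> 0"
      unfolding mem_diff_set image_iff by (metis Diff_iff mem_diff_set singletonI)
    thus "z \<in> {\<bar>real_of_int (x - y)\<bar> | x y. x \<in> A \<and> y \<in> A \<and> x \<noteq> y}" by auto
  qed
  finally show ?thesis .
qed

lemma card_distances_line_point_le:
  assumes "finite A"
  shows "card (distances (line_point ` A)) \<le> card (diff_set A A)"
  unfolding distances_line_point using assms
  by (intro order_trans[OF card_image_le card_mono]) (auto simp: finite_diff_set)

text \<open>Each nonzero difference is a distance up to sign, and the difference 0 adds one more.
  This is the source of the factor 1/2 in the local condition.\<close>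

lemma card_diff_set_le_distances:
  assumes "finite A"
  shows "card (diff_set A A) \<le> 2 * card (distances (line_point ` A)) + 1"
proof -
  let ?D = "distances (line_point ` A)"
  have fin: "finite ?D" unfolding distances_line_point using assms by (simp add: finite_diff_set)
  have "real_of_int ` diff_set A A \<subseteq> insert 0 (?D \<union> uminus ` ?D)"
  proof
    fix x assume "x \<in> real_of_int ` diff_set A A"
    then obtain d where d: "d \<in> diff_set A A" "x = real_of_int d" by auto
    show "x \<in> insert 0 (?D \<union> uminus ` ?D)"
    proof (cases "d = 0")
      case False
      hence "\<bar>x\<bar> \<in> ?D" using d by (auto simp: distances_line_point)
      moreover have "x = \<bar>x\<bar> \<or> x = - \<bar>x\<bar>" by linarith
      ultimately show ?thesis by (metis UnI1 UnI2 image_eqI insertI2)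
    qed (use d in simp)
  qed
  hence "card (real_of_int ` diff_set A A) \<le> card (insert 0 (?D \<union> uminus ` ?D))"
    using fin by (intro card_mono) auto
  also have "\<dots> \<le> Suc (card (?D \<union> uminus ` ?D))"
    by (rule card_insert_le_m1) auto
  also have "\<dots> \<le> Suc (card ?D + card ?D)"
    using card_Un_le[of ?D "uminus ` ?D"] card_image_le[OF fin, of uminus] by linarith
  finally show ?thesis by (subst (asm) card_image) (auto simp: inj_on_def)
qed

text \<open>The difference bound holds for all subsets of the cube, so every \<open>A\<close> inside
  it inherits the condition, for every \<open>k\<close> and without its size being a power of
  two.\<close>

lemma locally_rich_line_point:
  assumes "A \<subseteq> ternary_cube m"
  shows "locally_rich k (1 / 2 * real k powr log 2 3 - 1) (line_point ` A)"
  unfolding locally_rich_def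
proof (intro allI impI, elim conjE)
  fix T assume T: "T \<subseteq> line_point ` A" "card T = k"
  then obtain B where B: "B \<subseteq> A" "T = line_point ` B" by (metis subset_image_iff)
  have fin: "finite B" using B assms finite_ternary_cube finite_subset by metis
  have k: "card B = k" using T B by (metis card_image inj_line_point inj_on_subset subset_UNIV)
  have "real k powr log 2 3 = (real k * real k) powr (log 2 3 / 2)"
    by (subst powr_mult) (simp_all flip: powr_add)
  also have "\<dots> \<le> card (diff_set B B)"
    using card_diff_set_ge[of B m B] B assms k by auto
  also have "\<dots> \<le> real (2 * card (distances T) + 1)"
    using card_diff_set_le_distances[OF fin] B by (simp only: of_nat_le_iff)
  \<comment> \<open>The chain even gives the threshold with 1/2 subtracted in place of 1.\<close>
  finally show "1 / 2 * real k powr log 2 3 - 1 \<le> real (card (distances T))" by simp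
qed

section \<open>Choice of the cube and the global upper bound\<close>

lemma exists_power_of_two_between:
  fixes n :: nat
  assumes "0 < n"
  obtains m where "n \<le> 2 ^ m" "2 ^ m \<le> 2 * n"
proof -
  define m where "m = (LEAST m. n \<le> 2 ^ m)"
  have m: "n \<le> 2 ^ m" unfolding m_def by (rule LeastI[of _ n]) (simp add: less_imp_le)
  \<comment> \<open>Minimality gives \<open>2 ^ (m - 1) < n\<close> for positive \<open>m\<close>;
    for \<open>m = 0\<close> the claim is \<open>1 \<le> 2 * n\<close>.\<close>
  have "2 ^ m \<le> 2 * n"
  proof (cases m)
    case (Suc j)
    hence "\<not> n \<le> 2 ^ j" using not_less_Least[of j "\<lambda>m. n \<le> 2 ^ m"] by (simp add: m_def)
    thus ?thesis using Suc by simp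
  qed (use assms in simp)
  with m show ?thesis by (rule that)
qed

lemma \<phi>_le_three_mult_powr:
  assumes "0 < n"
  shows "ereal_of_enat (\<phi> n k (1 / 2 * real k powr log 2 3 - 1)) \<le> ereal (3 * real n powr log 2 3)"
proof -
  obtain m where m: "n \<le> 2 ^ m" "2 ^ m \<le> 2 * n"
    using exists_power_of_two_between[OF assms] .
  obtain A where A: "A \<subseteq> ternary_cube m" "card A = n" "finite A"
    using obtain_subset_with_card_n[of n "ternary_cube m"] m(1) by (auto simp: card_ternary_cube)
  let ?S = "line_point ` A"
  have "card ?S = n" using A by (metis card_image inj_line_point inj_on_subset subset_UNIV)
  hence "\<phi> n k (1 / 2 * real k powr log 2 3 - 1) \<le> enat (card (distances ?S))"
    unfolding \<phi>_def using A locally_rich_line_point[OF A(1)] by (intro INF_lower) auto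
  hence "ereal_of_enat (\<phi> n k (1 / 2 * real k powr log 2 3 - 1))
      \<le> ereal_of_enat (enat (card (distances ?S)))"
    by (simp only: ereal_of_enat_le_iff)
  also have "\<dots> = ereal (real (card (distances ?S)))"
    by simp
  also have "ereal (real (card (distances ?S))) \<le> ereal (3 * real n powr log 2 3)"
  proof -
    have "card (distances ?S) \<le> card (diff_set A A)"
      by (rule card_distances_line_point_le[OF A(3)])
    also have "\<dots> \<le> card (diff_set (ternary_cube m) (ternary_cube m))"
      using A(1) by (intro card_mono finite_diff_set finite_ternary_cube) (auto simp: diff_set_def)
    finally have "real (card (distances ?S)) \<le> 3 ^ m"
      unfolding card_diff_set_ternary_cube by (metis of_nat_le_iff of_nat_numeral of_nat_power)
    also have "(3::real) ^ m = (2 powr log 2 3) powr real m"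
      by (simp add: powr_realpow)
    also have "\<dots> = (2 powr real m) powr log 2 3"
      by (simp only: powr_powr mult.commute)
    also have "\<dots> = (2 ^ m) powr log 2 3"
      by (simp add: powr_realpow)
    \<comment> \<open>Rounding \<open>n\<close> up to a power of two costs a factor of at most
      \<open>2 powr log 2 3 = 3\<close>, which is the final constant.\<close>
    also have "\<dots> \<le> (2 * real n) powr log 2 3"
      using m(2) log_2_3_bounds by (intro powr_mono2) (auto simp flip: of_nat_le_iff[where 'a = real])
    also have "\<dots> = 3 * real n powr log 2 3"
      by (simp add: powr_mult)
    finally show ?thesis by simp
  qed
  finally show ?thesis .
qed

theorem theorem1p1:
  "\<exists>C>0. \<forall>n k :: nat. 0 < k \<and> k \<le> n \<longrightarrow>
     ereal_of_enat (\<phi> n k (1 / 2 * real k powr log 2 3 - 1))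
       \<le> ereal (C * real n powr log 2 3)"
  using \<phi>_le_three_mult_powr by (intro exI[of _ 3] conjI allI impI) auto

end
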